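(* Let $q$ be an odd prime and let $n\ge 1$ be an integer. Then $$q^n\sum_{y\in\mathbb{F}_q}\phi(y)\cdot{}_{n+1}F_n(y)=\left(-\phi(-1)\right)^{n+1}.$$
   Context: $\mathbb{F}_q$ is the finite field with $q$ elements; $\epsilon$ and $\phi$ are the trivial and quadratic multiplicative characters of $\mathbb{F}_q$. Every multiplicative character $\chi$ (including $\epsilon$) is extended to $\mathbb{F}_q$ by $\chi(0)=0$; $\overline{\chi}$ is the inverse character. For multiplicative characters $A,B$: $J(A,B)=\sum_{x\in\mathbb{F}_q}A(x)B(1-x)$ and $\binom{A}{B}=\frac{B(-1)}{q}J(A,\overline{B})$. For $n\ge1$ and $x\in\mathbb{F}_q$, $${}_{n+1}F_n(x):={}_{n+1}F_n\left(\begin{matrix}\phi & \phi & \cdots & \phi\\ & \epsilon & \cdots & \epsilon\end{matrix}\ \middle|\ x\right)=\frac{q}{q-1}\sum_{\chi}\binom{\phi\chi}{\chi}^{n+1}\chi(x),$$ the sum running over all multiplicative characters $\chi$ of $\mathbb{F}_q$. *)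

theory Defs
  imports Complex_Main "HOL-Library.Cardinality" "HOL-Computational_Algebra.Primes"
begin

text \<open>
  The field with $q$ elements is a type \<open>'a :: finite_field\<close> with \<open>CARD('a) = q\<close>.
  Multiplicative characters carry their extension by $\chi(0) = 0$; multiplicativity and
  $\chi(1) = 1$ force nonzero values on the units.
\<close>

definition mult_chars :: "('a :: finite_field \<Rightarrow> complex) set" where
  "mult_chars = {\<chi>. \<chi> 0 = 0 \<and> \<chi> 1 = 1 \<and> (\<forall>x y. \<chi> (x * y) = \<chi> x * \<chi> y)}"

definition quad_char :: "'a :: finite_field \<Rightarrow> complex" where
  "quad_char x = (if x = 0 then 0 else if \<exists>y. x = y ^ 2 then 1 else - 1)"

definition char_mult :: "('a :: finite_field \<Rightarrow> complex) \<Rightarrow> ('a \<Rightarrow> complex) \<Rightarrow> 'a \<Rightarrow> complex" where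
  "char_mult A B x = A x * B x"

text \<open>Since \<open>inverse 0 = 0\<close>, this respects the convention $\chi(0) = 0$.\<close>

definition char_inv :: "('a :: finite_field \<Rightarrow> complex) \<Rightarrow> 'a \<Rightarrow> complex" where
  "char_inv A x = inverse (A x)"

definition jacobi_sum :: "('a :: finite_field \<Rightarrow> complex) \<Rightarrow> ('a \<Rightarrow> complex) \<Rightarrow> complex" where
  "jacobi_sum A B = (\<Sum>x\<in>UNIV. A x * B (1 - x))"

definition char_binom :: "('a :: finite_field \<Rightarrow> complex) \<Rightarrow> ('a \<Rightarrow> complex) \<Rightarrow> complex" where
  "char_binom A B = B (- 1) / of_nat CARD('a) * jacobi_sum A (char_inv B)"

text \<open>
  \<open>hyp_F n x\<close> is ${}_{n+1}F_n(x)$, with all upper parameters quadratic and all lower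
  parameters trivial.
\<close>

definition hyp_F :: "nat \<Rightarrow> 'a :: finite_field \<Rightarrow> complex" where
  "hyp_F n x = of_nat CARD('a) / (of_nat CARD('a) - 1) *
     (\<Sum>\<chi>\<in>mult_chars. char_binom (char_mult quad_char \<chi>) \<chi> ^ (n + 1) * \<chi> x)"

text \<open>The sum in \<open>hyp_F\<close> ranges over a finite set, so it is not 0 by convention.\<close>

lemma finite_mult_chars: "finite (mult_chars :: ('a :: finite_field \<Rightarrow> complex) set)"
proof -
  define R :: "complex set" where "R = insert 0 {z. z ^ (CARD('a) - 1) = 1}"
  have "card {0 :: 'a, 1} \<le> CARD('a)"
    by (rule card_mono) auto
  then have q: "CARD('a) - 1 > 0" by simp
  have "\<chi> x \<in> R" if \<chi>: "\<chi> \<in> mult_chars" for \<chi> and x :: 'a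
  proof -
    have "\<chi> (x ^ m) = \<chi> x ^ m" for m
      using \<chi> by (induction m) (auto simp: mult_chars_def)
    from this[of "CARD('a)"] have eq: "\<chi> x = \<chi> x ^ CARD('a)"
      unfolding finite_field_power_card_eq_same .
    have "\<chi> x ^ CARD('a) = \<chi> x * \<chi> x ^ (CARD('a) - 1)"
      by (rule power_eq_if[THEN trans]) (use q in simp)
    then have "\<chi> x * \<chi> x ^ (CARD('a) - 1) = \<chi> x * 1"
      unfolding mult_1_right using eq by (rule trans[OF sym sym])
    then have "\<chi> x = 0 \<or> \<chi> x ^ (CARD('a) - 1) = 1"
      by (subst (asm) mult_cancel_left)
    then show ?thesis
      unfolding R_def by blast
  qed
  then have "mult_chars \<subseteq> {\<chi> :: 'a \<Rightarrow> complex. \<forall>x. (x \<in> UNIV \<longrightarrow> \<chi> x \<in> R) \<and> (x \<notin> UNIV \<longrightarrow> \<chi> x = 0)}"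
    by auto
  moreover have "finite R"
    unfolding R_def using q by (intro finite.insertI finite_roots_unity) linarith
  then have "finite {\<chi> :: 'a \<Rightarrow> complex. \<forall>x. (x \<in> UNIV \<longrightarrow> \<chi> x \<in> R) \<and> (x \<notin> UNIV \<longrightarrow> \<chi> x = 0)}"
    by (intro finite_set_of_finite_funs) auto
  ultimately show ?thesis
    by (rule finite_subset)
qed

end

theory Submission
  imports Defs "HOL-Number_Theory.Residues"
begin

text \<open>
  Exchanging the two sums, orthogonality of characters leaves only the summand
  \<open>\<chi> = \<phi>\<close>, for which the binomial coefficient is a multiple of
  \<open>J(\<epsilon>, \<phi>) = -\<phi>(1)\<close>.
\<close>

section \<open>Squares and nonsquares in a field of odd order\<close>

text \<open>Otherwise the characteristic, a prime dividing 2, would be 2; but the characteristic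
  divides the order of the field.\<close>

lemma odd_card_imp_neg_one_neq_one:
  assumes "odd (CARD('a :: finite_field))"
  shows "(- 1 :: 'a) \<noteq> 1"
proof
  assume "(- 1 :: 'a) = 1"
  then have "of_nat 2 = (0 :: 'a)"
    by (metis add_neg_numeral_special(8) neg_eq_iff_add_eq_0 of_nat_1 of_nat_numeral one_add_one)
  then have "CHAR('a) dvd 2"
    by (simp only: of_nat_eq_0_iff_char_dvd)
  moreover have "prime CHAR('a)"
    by (rule prime_CHAR_semidom) simp
  ultimately have "CHAR('a) = 2"
    by (metis primes_dvd_imp_eq two_is_prime_nat)
  then show False
    using CHAR_dvd_CARD[where 'a = 'a] assms by simp
qed

lemma one_less_card_field: "1 < CARD('a :: finite_field)"
proof -
  have "card {0 :: 'a, 1} \<le> CARD('a)"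
    by (rule card_mono) auto
  then show ?thesis by simp
qed

lemma square_fiber:
  fixes y :: "'a :: finite_field"
  shows "{x. x ^ 2 = y ^ 2} = {y, - y}"
  by (auto simp: power2_eq_iff)

text \<open>Squaring maps the nonzero elements onto the nonzero squares, and each fibre is a pair
  \<open>{y, - y}\<close> of distinct elements.\<close>

lemma card_nonzero_squares:
  assumes "odd (CARD('a :: finite_field))"
  shows "2 * card {x :: 'a. x \<noteq> 0 \<and> (\<exists>y. x = y ^ 2)} = CARD('a) - 1"
proof -
  let ?S = "{x :: 'a. x \<noteq> 0 \<and> (\<exists>y. x = y ^ 2)}"
  have fiber: "card {x :: 'a. x ^ 2 = s} = 2" if s: "s \<in> ?S" for s
  proof -
    obtain y where y: "s = y ^ 2" "y \<noteq> 0"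
      using s by auto
    have "y \<noteq> - y"
    proof
      assume "y = - y"
      then have "y * (- 1) = y * 1" by simp
      with y(2) odd_card_imp_neg_one_neq_one[OF assms] show False
        using mult_cancel_left by blast
    qed
    then show ?thesis
      unfolding y(1) square_fiber by simp
  qed
  have "UNIV - {0 :: 'a} = (\<Union>s\<in>?S. {x. x ^ 2 = s})"
    by auto
  then have "CARD('a) - 1 = card (\<Union>s\<in>?S. {x :: 'a. x ^ 2 = s})"
    by (metis card_Diff_singleton UNIV_I)
  also have "\<dots> = (\<Sum>s\<in>?S. card {x :: 'a. x ^ 2 = s})"
    by (rule card_UN_disjoint) auto
  also have "\<dots> = 2 * card ?S"
    using fiber by simp
  finally show ?thesis by simp
qed

lemma card_nonsquares:
  assumes "odd (CARD('a :: finite_field))"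
  shows "2 * card {x :: 'a. \<nexists>y. x = y ^ 2} = CARD('a) - 1"
proof -
  let ?S = "{x :: 'a. x \<noteq> 0 \<and> (\<exists>y. x = y ^ 2)}"
  let ?N = "{x :: 'a. \<nexists>y. x = y ^ 2}"
  \<comment> \<open>Zero is itself a square, so \<open>?N\<close> lies entirely among the nonzero
    elements.\<close>
  have "UNIV - {0} = ?S \<union> ?N"
    by auto
  then have "CARD('a) - 1 = card (?S \<union> ?N)"
    by (metis card_Diff_singleton UNIV_I)
  also have "\<dots> = card ?S + card ?N"
    by (rule card_Un_disjoint) auto
  finally show ?thesis
    using card_nonzero_squares[OF assms] by linarith
qed

text \<open>A counting argument: multiplication by the nonsquare \<open>a\<close> injects the
  nonzero squares into the nonsquares. Both sets have the same size, so the map is onto and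
  \<open>b\<close> has the form \<open>a * y ^ 2\<close>.\<close>

lemma mult_nonsquares:
  fixes a b :: "'a :: finite_field"
  assumes "odd (CARD('a))" and a: "\<nexists>y. a = y ^ 2" and b: "\<nexists>y. b = y ^ 2"
  shows "\<exists>y. a * b = y ^ 2"
proof -
  let ?S = "{x :: 'a. x \<noteq> 0 \<and> (\<exists>y. x = y ^ 2)}"
  let ?N = "{x :: 'a. \<nexists>y. x = y ^ 2}"
  have "a \<noteq> 0"
    using a by (metis zero_power2)
  have "(*) a ` ?S \<subseteq> ?N"
  proof clarsimp
    fix y z :: 'a
    assume "y \<noteq> 0" and "a * y ^ 2 = z ^ 2"
    then have "a = (z / y) ^ 2"
      by (simp add: field_simps power_divide)
    with a show False by blast
  qed
  moreover have "card ((*) a ` ?S) = card ?N"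
  proof -
    have "card ((*) a ` ?S) = card ?S"
      using \<open>a \<noteq> 0\<close> by (intro card_image inj_onI) simp
    then show ?thesis
      using card_nonzero_squares[OF assms(1)] card_nonsquares[OF assms(1)] by linarith
  qed
  ultimately have "(*) a ` ?S = ?N"
    by (intro card_subset_eq) auto
  with b obtain y where "b = a * y ^ 2"
    by blast
  then have "a * b = (a * y) ^ 2"
    by (simp add: power2_eq_square)
  then show ?thesis ..
qed

lemma mult_square_is_square_iff:
  fixes a y :: "'a :: finite_field"
  assumes "y \<noteq> 0"
  shows "(\<exists>z. a * y ^ 2 = z ^ 2) \<longleftrightarrow> (\<exists>z. a = z ^ 2)"
proof
  assume "\<exists>z. a * y ^ 2 = z ^ 2"
  then obtain z where "a * y ^ 2 = z ^ 2" ..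
  with assms have "a = (z / y) ^ 2"
    by (simp add: field_simps power_divide)
  then show "\<exists>z. a = z ^ 2" ..
qed (metis power_mult_distrib)

section \<open>The quadratic character\<close>

text \<open>Away from zero, a square factor does not change whether the product is a square, and two
  nonsquares multiply to a square.\<close>

lemma quad_char_mult:
  fixes a b :: "'a :: finite_field"
  assumes "odd (CARD('a))"
  shows "quad_char (a * b) = quad_char a * quad_char b"
proof (cases "a = 0 \<or> b = 0")
  case False
  then have *: "a \<noteq> 0" "b \<noteq> 0" by auto
  consider y where "a = y ^ 2" | y where "b = y ^ 2"
    | "\<nexists>y. a = y ^ 2" "\<nexists>y. b = y ^ 2" by blast
  then show ?thesis
  proof cases
    case (1 y)
    with * have "y \<noteq> 0" by auto
    from mult_square_is_square_iff[OF this, of b] show ?thesis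
      using * 1 by (auto simp: quad_char_def mult.commute)
  next
    case (2 y)
    with * have "y \<noteq> 0" by auto
    from mult_square_is_square_iff[OF this, of a] show ?thesis
      using * 2 by (auto simp: quad_char_def)
  next
    case 3
    from mult_nonsquares[OF assms this] show ?thesis
      using * 3 by (simp add: quad_char_def)
  qed
qed (auto simp: quad_char_def)

lemma quad_char_0 [simp]: "quad_char 0 = 0"
  by (simp add: quad_char_def)

lemma quad_char_1 [simp]: "quad_char 1 = 1"
  by (auto simp: quad_char_def intro: exI[of _ 1])

lemma quad_char_mult_self: "quad_char x * quad_char x = (if x = 0 then 0 else 1)"
  by (simp add: quad_char_def)

lemma quad_char_in_mult_chars:
  assumes "odd (CARD('a :: finite_field))"
  shows "(quad_char :: 'a \<Rightarrow> complex) \<in> mult_chars"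
  by (simp add: mult_chars_def quad_char_mult[OF assms])

lemma char_mult_in_mult_chars:
  "A \<in> mult_chars \<Longrightarrow> B \<in> mult_chars \<Longrightarrow> char_mult A B \<in> mult_chars"
  by (simp add: mult_chars_def char_mult_def)

section \<open>Orthogonality\<close>

text \<open>Multiplication by \<open>a\<close> permutes the field, so the sum equals
  \<open>\<psi> a\<close> times itself.\<close>

lemma sum_mult_char_nontrivial:
  fixes \<psi> :: "'a :: finite_field \<Rightarrow> complex"
  assumes \<psi>: "\<psi> \<in> mult_chars" and a: "a \<noteq> 0" "\<psi> a \<noteq> 1"
  shows "(\<Sum>x\<in>UNIV. \<psi> x) = 0"
proof -
  have "(\<Sum>x\<in>UNIV. \<psi> x) = (\<Sum>x\<in>UNIV. \<psi> (a * x))"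
    by (rule sum.reindex_bij_witness[of _ "\<lambda>x. a * x" "\<lambda>x. x / a"]) (use a in auto)
  also have "\<dots> = \<psi> a * (\<Sum>x\<in>UNIV. \<psi> x)"
    using \<psi> by (simp add: mult_chars_def sum_distrib_left)
  finally show ?thesis
    using a(2) by simp
qed

lemma sum_quad_char:
  assumes "odd (CARD('a :: finite_field))"
  shows "(\<Sum>x\<in>(UNIV :: 'a set). quad_char x) = 0"
proof -
  \<comment> \<open>The count of nonsquares provides one; there \<open>quad_char\<close> is -1, so
    the character is nontrivial.\<close>
  have "card {x :: 'a. \<nexists>y. x = y ^ 2} \<noteq> 0"
    using card_nonsquares[OF assms] one_less_card_field[where 'a = 'a] by linarith
  then have "{x :: 'a. \<nexists>y. x = y ^ 2} \<noteq> {}"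
    by (metis card.empty)
  then obtain a :: 'a where a: "\<nexists>y. a = y ^ 2"
    by blast
  then have "a \<noteq> 0" by (metis zero_power2)
  with a show ?thesis
    by (intro sum_mult_char_nontrivial[OF quad_char_in_mult_chars[OF assms]])
       (auto simp: quad_char_def)
qed

text \<open>As \<open>quad_char\<close> is its own inverse, its product with \<open>\<chi>\<close>
  is trivial exactly when the two agree.\<close>

lemma sum_quad_char_times_mult_char:
  fixes \<chi> :: "'a :: finite_field \<Rightarrow> complex"
  assumes odd: "odd (CARD('a))" and \<chi>: "\<chi> \<in> mult_chars"
  shows "(\<Sum>y\<in>UNIV. quad_char y * \<chi> y) = (if \<chi> = quad_char then of_nat CARD('a) - 1 else 0)"
proof (cases "\<chi> = quad_char")
  case True
  have "(\<Sum>y\<in>(UNIV :: 'a set). quad_char y * quad_char y) = (\<Sum>y\<in>UNIV - {0 :: 'a}. (1 :: complex))"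
    by (rule sum.mono_neutral_cong_right) (auto simp: quad_char_mult_self)
  also have "\<dots> = of_nat CARD('a) - 1"
    by (simp add: card_Diff_singleton of_nat_diff Suc_leI)
  finally show ?thesis
    using True by simp
next
  case False
  then obtain a where a: "\<chi> a \<noteq> quad_char a" by auto
  have "\<chi> 0 = 0"
    using \<chi> by (simp add: mult_chars_def)
  with a have "a \<noteq> 0" by auto
  \<comment> \<open>Since \<open>quad_char a\<close> squares to 1, a product equal to 1 would force
    \<open>\<chi> a = quad_char a\<close>.\<close>
  moreover have "char_mult quad_char \<chi> a \<noteq> 1"
    using a quad_char_mult_self[of a] \<open>a \<noteq> 0\<close>
    by (metis char_mult_def mult_cancel_left mult_zero_left zero_neq_one)
  ultimately have "(\<Sum>y\<in>UNIV. char_mult quad_char \<chi> y) = 0"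
    by (intro sum_mult_char_nontrivial[OF char_mult_in_mult_chars[OF quad_char_in_mult_chars[OF odd] \<chi>]])
  with False show ?thesis
    by (simp add: char_mult_def)
qed

section \<open>The surviving binomial coefficient\<close>

lemma char_inv_quad_char: "char_inv quad_char = quad_char"
  by (auto simp: char_inv_def quad_char_def)

text \<open>The first argument is the trivial character, which only removes the term at
  \<open>x = 0\<close>. The full sum of \<open>quad_char (1 - x)\<close> vanishes, and the removed
  term is \<open>quad_char 1 = 1\<close>.\<close>

lemma jacobi_sum_trivial_quad_char:
  assumes "odd (CARD('a :: finite_field))"
  shows "jacobi_sum (char_mult quad_char quad_char) (quad_char :: 'a \<Rightarrow> complex) = - 1"
proof -
  have "jacobi_sum (char_mult quad_char quad_char) (quad_char :: 'a \<Rightarrow> complex)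
      = (\<Sum>x\<in>UNIV - {0 :: 'a}. quad_char (1 - x))"
    unfolding jacobi_sum_def char_mult_def quad_char_mult_self
    by (rule sum.mono_neutral_cong_right) auto
  also have "\<dots> = (\<Sum>x\<in>(UNIV :: 'a set). quad_char (1 - x)) - 1"
    by (subst sum_diff1) auto
  also have "(\<Sum>x\<in>(UNIV :: 'a set). quad_char (1 - x)) = (\<Sum>x\<in>(UNIV :: 'a set). quad_char x)"
    by (rule sum.reindex_bij_witness[of _ "\<lambda>x. 1 - x" "\<lambda>x. 1 - x"]) auto
  finally show ?thesis
    by (simp add: sum_quad_char[OF assms])
qed

lemma char_binom_trivial_quad_char:
  assumes "odd (CARD('a :: finite_field))"
  shows "of_nat CARD('a) * char_binom (char_mult quad_char quad_char) (quad_char :: 'a \<Rightarrow> complex)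
           = - quad_char (- 1 :: 'a)"
  by (simp add: char_binom_def char_inv_quad_char jacobi_sum_trivial_quad_char[OF assms])

lemma sum_quad_char_hyp_F:
  assumes odd: "odd (CARD('a :: finite_field))"
  shows "(\<Sum>y\<in>(UNIV :: 'a set). quad_char y * hyp_F n y) =
    of_nat CARD('a) * char_binom (char_mult quad_char quad_char) (quad_char :: 'a \<Rightarrow> complex) ^ (n + 1)"
proof -
  let ?q = "of_nat CARD('a) :: complex"
  let ?c = "\<lambda>\<chi> :: 'a \<Rightarrow> complex. char_binom (char_mult quad_char \<chi>) \<chi> ^ (n + 1)"
  have q: "?q - 1 \<noteq> 0"
    using one_less_card_field[where 'a = 'a] by simp
  have "(\<Sum>y\<in>(UNIV :: 'a set). quad_char y * hyp_F n y)
      = (\<Sum>y\<in>UNIV. \<Sum>\<chi>\<in>mult_chars. ?q / (?q - 1) * ?c \<chi> * (quad_char y * \<chi> y))"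
    unfolding hyp_F_def sum_distrib_left by (intro sum.cong refl) (simp only: mult_ac)
  also have "\<dots> = (\<Sum>\<chi>\<in>mult_chars. ?q / (?q - 1) * ?c \<chi> * (\<Sum>y\<in>UNIV. quad_char y * \<chi> y))"
    unfolding sum_distrib_left by (rule sum.swap)
  \<comment> \<open>At \<open>\<chi> = quad_char\<close> the inner sum is \<open>?q - 1\<close>,
    which cancels the denominator of the prefactor.\<close>
  also have "\<dots> = (\<Sum>\<chi>\<in>(mult_chars :: ('a \<Rightarrow> complex) set). if \<chi> = quad_char then ?q * ?c quad_char else 0)"
  proof (rule sum.cong[OF refl])
    fix \<chi> :: "'a \<Rightarrow> complex"
    assume "\<chi> \<in> mult_chars"
    then show "?q / (?q - 1) * ?c \<chi> * (\<Sum>y\<in>UNIV. quad_char y * \<chi> y)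
        = (if \<chi> = quad_char then ?q * ?c quad_char else 0)"
      using q by (simp add: sum_quad_char_times_mult_char[OF odd])
  qed
  also have "\<dots> = ?q * ?c quad_char"
    using quad_char_in_mult_chars[OF odd] by (simp add: finite_mult_chars)
  finally show ?thesis .
qed

theorem proposition4p3:
  fixes q n :: nat
  assumes "prime q" and "odd q"
    and "CARD('a :: finite_field) = q"
    and "n \<ge> 1"
  shows "of_nat q ^ n * (\<Sum>y\<in>(UNIV :: 'a set). quad_char y * hyp_F n y)
           = (- quad_char (- 1 :: 'a)) ^ (n + 1)"
proof -
  have odd: "odd (CARD('a))"
    using assms by simp
  show ?thesis
    \<comment> \<open>The second equation is used from right to left, turning the base on the right
      into \<open>q\<close> times the binomial coefficient. Both sides then carry
      \<open>q ^ (n + 1)\<close>: on the left, \<open>n\<close> factors are explicit and one comes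
      from the evaluated sum.\<close>
    unfolding sum_quad_char_hyp_F[OF odd] char_binom_trivial_quad_char[OF odd, symmetric]
    using assms(3) by (simp add: power_mult_distrib)
qed

end
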